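(* Let $\lambda\in(0,1]$ and let $X\sim DB_\lambda(\alpha,\theta)$. Then \[ E[X]=\theta\alpha\, e_\lambda^{1-\lambda}(\theta),\qquad \mathrm{Var}(X)=\theta\alpha\big(1+\theta(1-\lambda)e_\lambda^{-\lambda}(\theta)\big)e_\lambda^{1-\lambda}(\theta). \]
   Context: For nonzero real $\lambda$, the degenerate exponential is $e_\lambda^x(t)=(1+\lambda t)^{x/\lambda}=\sum_{n=0}^\infty \frac{(x)_{n,\lambda}}{n!}t^n$, with $e_\lambda(t)=e_\lambda^1(t)$, where $(x)_{0,\lambda}=1$ and $(x)_{n,\lambda}=x(x-\lambda)\cdots(x-(n-1)\lambda)$ for $n\ge1$. The degenerate Bell polynomials $\phi_{n,\lambda}(x)$ are defined by $e^{x(e_\lambda(t)-1)}=\sum_{n=0}^\infty \phi_{n,\lambda}(x)\frac{t^n}{n!}$. A discrete random variable $X$ taking values in $\{0,1,2,\dots\}$ has the degenerate Bell distribution with parameters $(\alpha,\theta)\in\mathbb{R}^2$, written $X\sim DB_\lambda(\alpha,\theta)$, if $P\{X=k\}=e^{-\alpha(e_\lambda(\theta)-1)}\frac{\theta^k}{k!}\phi_{k,\lambda}(\alpha)$ for all $k\ge0$ (parameters being such that these numbers form a probability mass function). *)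

theory Defs
  imports
    "HOL-Probability.Probability"
    "HOL-Computational_Algebra.Formal_Power_Series"
begin

text \<open>
  The real power \<open>b\<^sup>a\<close> with the usual domain: \<open>b > 0\<close> and \<open>a\<close> arbitrary, or \<open>a\<close> an integer and
  \<open>b\<close> arbitrary. \<open>(powr)\<close> alone gives the wrong value when \<open>b \<le> 0\<close> and \<open>a\<close> is an integer, for
  instance \<open>0 powr 0 = 0\<close>. That case does occur below: for \<open>lam = 1\<close> the degenerate exponential
  is \<open>1 + t\<close>, the degenerate Bell distribution is Poisson with mean \<open>\<alpha> * \<theta>\<close>, and \<open>1 + \<theta> \<le> 0\<close>
  is possible (with \<open>\<alpha> \<le> 0\<close>).
\<close>

definition real_power :: "real \<Rightarrow> real \<Rightarrow> real" where
  "real_power b a = (if a \<in> \<int> then b powi \<lfloor>a\<rfloor> else b powr a)"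

lemma real_power_eq_powr: "b > 0 \<Longrightarrow> real_power b a = b powr a"
  by (auto simp: real_power_def elim!: Ints_cases simp: powr_real_of_int')

definition degenerate_exp :: "real \<Rightarrow> real \<Rightarrow> real \<Rightarrow> real" where
  "degenerate_exp lam x t = real_power (1 + lam * t) (x / lam)"

definition degenerate_ffact :: "real \<Rightarrow> real \<Rightarrow> nat \<Rightarrow> real" where
  "degenerate_ffact lam x n = (\<Prod>i<n. x - real i * lam)"

definition degenerate_exp_fps :: "real \<Rightarrow> real \<Rightarrow> real fps" where
  "degenerate_exp_fps lam x = Abs_fps (\<lambda>n. degenerate_ffact lam x n / fact n)"

lemma degenerate_exp_fps_sums:
  assumes "lam \<noteq> 0" "\<bar>lam * t\<bar> < 1"
  shows "(\<lambda>n. fps_nth (degenerate_exp_fps lam x) n * t ^ n) sums degenerate_exp lam x t"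
proof -
  have "(x / lam gchoose n) * (lam * t) ^ n = fps_nth (degenerate_exp_fps lam x) n * t ^ n" for n
  proof -
    have "degenerate_ffact lam x n = (\<Prod>i<n. lam * (x / lam - real i))"
      unfolding degenerate_ffact_def using assms(1)
      by (intro prod.cong) (auto simp: field_simps)
    also have "\<dots> = lam ^ n * (\<Prod>i<n. x / lam - real i)"
      by (simp add: prod.distrib)
    finally show ?thesis
      by (simp add: degenerate_exp_fps_def gbinomial_prod_rev atLeast0LessThan power_mult_distrib)
  qed
  moreover have "(\<lambda>n. (x / lam gchoose n) * (lam * t) ^ n) sums ((1 + lam * t) powr (x / lam))"
    by (rule gen_binomial_real) (use assms in auto)
  moreover have "1 + lam * t > 0"
    using assms(2) by linarith
  ultimately show ?thesis
    by (simp add: degenerate_exp_def real_power_eq_powr)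
qed

text \<open>
  The generating function \<open>exp (x * (e(t) - 1))\<close> is the formal composition of \<open>exp (x * u)\<close> with
  \<open>u = e(t) - 1\<close>, which is legitimate because \<open>e(t) - 1\<close> has no constant term.
\<close>

lemma degenerate_exp_fps_nth_0: "fps_nth (degenerate_exp_fps lam x - 1) 0 = 0"
  by (simp add: degenerate_exp_fps_def degenerate_ffact_def)

definition degenerate_bell :: "real \<Rightarrow> nat \<Rightarrow> real \<Rightarrow> real" where
  "degenerate_bell lam n x =
     fact n * fps_nth (fps_compose (fps_exp x) (degenerate_exp_fps lam 1 - 1)) n"

text \<open>
  The point probabilities are required to equal the given reals, so for a random variable on a
  probability space the condition forces these numbers to be nonnegative with sum 1.
\<close>

definition has_degenerate_bell_distribution ::
    "'a measure \<Rightarrow> ('a \<Rightarrow> nat) \<Rightarrow> real \<Rightarrow> real \<Rightarrow> real \<Rightarrow> bool" where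
  "has_degenerate_bell_distribution M X lam \<alpha> \<theta> \<longleftrightarrow>
     X \<in> measurable M (count_space UNIV) \<and>
     (\<forall>k. measure M {\<omega> \<in> space M. X \<omega> = k} =
        exp (- \<alpha> * (degenerate_exp lam 1 \<theta> - 1)) * (\<theta> ^ k / fact k) * degenerate_bell lam k \<alpha>)"

end

theory Submission
  imports Defs "HOL-Complex_Analysis.Laurent_Convergence"
begin

text \<open>
  The probability generating function \<open>h s = (\<Sum>k. P(X = k) * s ^ k)\<close> is a constant multiple of
  \<open>exp (\<alpha> * (e(\<theta> * s) - 1))\<close>. Since its coefficients are nonnegative, the mean and the second factorial
  moment are the limits of \<open>h'\<close> and \<open>h''\<close> as \<open>s\<close> tends to 1 from below, whenever these limits
  exist; this also covers the boundary case \<open>\<theta> = 1 / lam\<close>. If \<open>\<theta> = - 1 / lam\<close> and \<open>lam < 1\<close>, the mean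
  vanishes, so \<open>X = 0\<close> almost surely.

  The case \<open>\<bar>lam * \<theta>\<bar> > 1\<close> is impossible unless \<open>\<alpha> = 0\<close> or \<open>1 / lam\<close> is a natural number: convergence
  beyond the radius \<open>1 / lam\<close> would continue \<open>exp (\<alpha> * (e(z) - 1))\<close>, and with it its logarithmic derivative
  \<open>\<alpha> * (1 + lam * z) powr (1 / lam - 1)\<close>, holomorphically across \<open>- 1 / lam\<close>, and the exponent
  \<open>1 / lam - 1\<close>, being the order of the zero there, would be a natural number. When \<open>1 / lam\<close> is a natural number, the generating function is entire.
\<close>

section \<open>Complex expansion of the Bell generating function\<close>

text \<open>Complex coefficients give access to holomorphic functions, whose expansion at 0
  converges to them on every disc around 0 where they are holomorphic.\<close>

definition fps_of_real :: "real fps \<Rightarrow> complex fps" where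
  "fps_of_real F = Abs_fps (\<lambda>n. complex_of_real (fps_nth F n))"

lemma fps_of_real_nth [simp]: "fps_nth (fps_of_real F) n = complex_of_real (fps_nth F n)"
  by (simp add: fps_of_real_def)

lemma fps_of_real_power: "fps_of_real (F ^ k) = fps_of_real F ^ k"
proof (induction k)
  case (Suc k)
  have "fps_of_real (F * F ^ k) = fps_of_real F * fps_of_real (F ^ k)"
    by (simp add: fps_eq_iff fps_mult_nth)
  with Suc show ?case by simp
qed (simp add: fps_eq_iff)

lemma fps_of_real_compose:
  "fps_of_real (fps_compose F G) = fps_compose (fps_of_real F) (fps_of_real G)"
  by (simp add: fps_eq_iff fps_compose_nth flip: fps_of_real_power)

lemma degenerate_exp_fps_nth_eq_gbinomial:
  assumes "lam \<noteq> 0"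
  shows "fps_nth (degenerate_exp_fps lam x) n = (x / lam gchoose n) * lam ^ n"
proof -
  have "degenerate_ffact lam x n = (\<Prod>i<n. lam * (x / lam - real i))"
    unfolding degenerate_ffact_def using assms by (intro prod.cong) (auto simp: field_simps)
  also have "\<dots> = lam ^ n * (\<Prod>i<n. x / lam - real i)"
    by (simp add: prod.distrib)
  finally show ?thesis
    by (simp add: degenerate_exp_fps_def gbinomial_prod_rev atLeast0LessThan)
qed

lemma of_real_gbinomial: "complex_of_real (a gchoose n) = (complex_of_real a gchoose n)"
  by (simp add: gbinomial_prod_rev)

lemma has_fps_expansion_degenerate_exp:
  assumes "lam > 0"
  shows "(\<lambda>z. (1 + of_real lam * z) powr of_real (x / lam)) has_fps_expansion
    fps_of_real (degenerate_exp_fps lam x)"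
proof (rule has_fps_expansionI)
  have "eventually (\<lambda>z::complex. z \<in> ball 0 (1 / lam)) (nhds 0)"
    using assms by (intro eventually_nhds_in_open) auto
  then show "\<forall>\<^sub>F z in nhds 0. (\<lambda>n. fps_nth (fps_of_real (degenerate_exp_fps lam x)) n * z ^ n)
      sums ((1 + of_real lam * z) powr of_real (x / lam))"
  proof eventually_elim
    case (elim z)
    then have "norm (of_real lam * z) < 1"
      using assms by (simp add: norm_mult field_simps)
    from gen_binomial_complex[OF this, of "of_real (x / lam)"] show ?case
      using assms by (simp add: degenerate_exp_fps_nth_eq_gbinomial of_real_gbinomial
          power_mult_distrib mult.assoc)
  qed
qed

text \<open>The exponential generating function of the degenerate Bell polynomials: its coefficient
  at \<open>n\<close> is \<open>degenerate_bell lam n x / fact n\<close>.\<close>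

definition bell_fps :: "real \<Rightarrow> real \<Rightarrow> real fps" where
  "bell_fps lam x = fps_compose (fps_exp x) (degenerate_exp_fps lam 1 - 1)"

text \<open>Expansions compose because \<open>degenerate_exp_fps lam 1 - 1\<close> has constant term
  zero.\<close>

lemma has_fps_expansion_bell_fps:
  assumes "lam > 0"
  shows "(\<lambda>z. exp (of_real \<alpha> * ((1 + of_real lam * z) powr of_real (1 / lam) - 1)))
    has_fps_expansion fps_of_real (bell_fps lam \<alpha>)"
proof -
  have "(\<lambda>z. exp (of_real \<alpha> * z)) has_fps_expansion fps_exp (complex_of_real \<alpha>)"
    by (rule has_fps_expansion_exp)
  moreover have "(\<lambda>z. (1 + of_real lam * z) powr of_real (1 / lam) - 1) has_fps_expansion
      fps_of_real (degenerate_exp_fps lam 1) - 1"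
    by (intro has_fps_expansion_diff has_fps_expansion_degenerate_exp assms has_fps_expansion_1)
  ultimately have "((\<lambda>z. exp (of_real \<alpha> * z)) \<circ>
      (\<lambda>z. (1 + of_real lam * z) powr of_real (1 / lam) - 1)) has_fps_expansion
      fps_compose (fps_exp (complex_of_real \<alpha>)) (fps_of_real (degenerate_exp_fps lam 1) - 1)"
    by (rule has_fps_expansion_compose)
      (simp add: degenerate_exp_fps_def degenerate_ffact_def)
  moreover have "fps_of_real (bell_fps lam \<alpha>) =
      fps_compose (fps_exp (complex_of_real \<alpha>)) (fps_of_real (degenerate_exp_fps lam 1) - 1)"
  proof -
    have "fps_of_real (fps_exp \<alpha>) = fps_exp (complex_of_real \<alpha>)"
      by (simp add: fps_eq_iff)
    moreover have "fps_of_real (degenerate_exp_fps lam 1 - 1) =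
        fps_of_real (degenerate_exp_fps lam 1) - 1"
      by (simp add: fps_eq_iff)
    ultimately show ?thesis
      by (simp only: bell_fps_def fps_of_real_compose)
  qed
  ultimately show ?thesis by (simp add: o_def)
qed

text \<open>Keeps the base of \<open>powr\<close> off its branch cut.\<close>

lemma one_plus_notin_nonpos_Reals:
  fixes w :: complex
  assumes "norm w < 1"
  shows "1 + w \<notin> \<real>\<^sub>\<le>\<^sub>0"
proof
  assume "1 + w \<in> \<real>\<^sub>\<le>\<^sub>0"
  then have "Re w \<le> -1" by (simp add: complex_nonpos_Reals_iff)
  with abs_Re_le_cmod[of w] assms show False by linarith
qed

text \<open>The closed form is holomorphic on the disc of radius \<open>1 / lam\<close>, so its
  expansion at 0 converges to it on all of that disc.\<close>

lemma bell_fps_sums_complex: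
  fixes z :: complex
  assumes "lam > 0" and "norm (of_real lam * z) < 1"
  shows "(\<lambda>n. of_real (fps_nth (bell_fps lam \<alpha>) n) * z ^ n) sums
    exp (of_real \<alpha> * ((1 + of_real lam * z) powr of_real (1 / lam) - 1))"
proof -
  have "(\<lambda>z. exp (of_real \<alpha> * ((1 + of_real lam * z) powr of_real (1 / lam) - 1)))
      holomorphic_on eball 0 (ereal (1 / lam))"
  proof (intro holomorphic_intros)
    fix z :: complex assume "z \<in> eball 0 (ereal (1 / lam))"
    then have "norm (of_real lam * z) < 1"
      using assms(1) by (simp add: norm_mult field_simps)
    then show "1 + of_real lam * z \<notin> \<real>\<^sub>\<le>\<^sub>0" by (rule one_plus_notin_nonpos_Reals)
  qed
  from has_fps_expansion_imp_sums_complex[OF has_fps_expansion_bell_fps[OF assms(1)] this, of z]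
  show ?thesis using assms by (simp add: norm_mult field_simps)
qed

text \<open>For natural \<open>1 / lam\<close> the degenerate exponential is a polynomial, so the
  generating function is entire and \<open>t\<close> is unrestricted.\<close>

lemma bell_fps_sums_Nats:
  assumes "lam > 0" and "1 / lam = real m"
  shows "(\<lambda>n. fps_nth (bell_fps lam \<alpha>) n * t ^ n) sums exp (\<alpha> * ((1 + lam * t) ^ m - 1))"
proof -
  let ?f = "\<lambda>z. exp (complex_of_real \<alpha> * ((1 + of_real lam * z) ^ m - 1))"
  let ?g = "\<lambda>z. exp (complex_of_real \<alpha> * ((1 + of_real lam * z) powr of_real (1 / lam) - 1))"
  have "eventually (\<lambda>z::complex. z \<in> ball 0 (1 / lam)) (nhds 0)"
    using assms(1) by (intro eventually_nhds_in_open) auto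
  \<comment> \<open>An expansion depends only on the germ at 0, so the polynomial may replace the
    branch of \<open>powr\<close>.\<close>
  then have ev: "eventually (\<lambda>z. ?g z = ?f z) (nhds 0)"
  proof eventually_elim
    case (elim z)
    then have "norm (of_real lam * z) < 1"
      using assms(1) by (simp add: norm_mult field_simps)
    then have "1 + of_real lam * z \<noteq> 0"
      using one_plus_notin_nonpos_Reals by (metis nonpos_Reals_zero_I)
    then show ?case by (simp only: assms(2) of_real_of_nat_eq powr_nat if_False)
  qed
  have "?f has_fps_expansion fps_of_real (bell_fps lam \<alpha>)"
    by (rule has_fps_expansion_cong[OF ev refl, THEN iffD1])
      (rule has_fps_expansion_bell_fps[OF assms(1)])
  moreover have "?f holomorphic_on eball 0 \<infinity>"
    by (intro holomorphic_intros)
  ultimately have "(\<lambda>n. fps_nth (fps_of_real (bell_fps lam \<alpha>)) n * of_real t ^ n) sums ?f (of_real t)"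
    by (rule has_fps_expansion_imp_sums_complex) simp
  also have "?f (of_real t) = of_real (exp (\<alpha> * ((1 + lam * t) ^ m - 1)))"
    by (simp flip: exp_of_real)
  finally have "(\<lambda>n. complex_of_real (fps_nth (bell_fps lam \<alpha>) n * t ^ n)) sums
      of_real (exp (\<alpha> * ((1 + lam * t) ^ m - 1)))" by simp
  then show ?thesis by (simp only: sums_of_real_iff)
qed

lemma real_power_of_nat [simp]: "real_power b (real m) = b ^ m"
  by (simp add: real_power_def)

lemma bell_fps_sums:
  assumes "lam > 0" and "\<bar>lam * t\<bar> < 1 \<or> 1 / lam \<in> \<nat>"
  shows "(\<lambda>n. fps_nth (bell_fps lam \<alpha>) n * t ^ n) sums exp (\<alpha> * (degenerate_exp lam 1 t - 1))"
  using assms(2)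
proof
  assume "1 / lam \<in> \<nat>"
  then obtain m where "1 / lam = real m" by (elim Nats_cases)
  with bell_fps_sums_Nats[OF assms(1) this, of \<alpha> t] show ?thesis
    by (simp only: degenerate_exp_def real_power_of_nat)
next
  assume *: "\<bar>lam * t\<bar> < 1"
  then have pos: "1 + lam * t > 0" by linarith
  have "(\<lambda>n. complex_of_real (fps_nth (bell_fps lam \<alpha>) n * t ^ n)) sums
    exp (of_real \<alpha> * ((1 + of_real lam * of_real t) powr of_real (1 / lam) - 1))"
    using bell_fps_sums_complex[OF assms(1), of "of_real t" \<alpha>] * by (simp add: norm_mult abs_mult)
  also have "(1 + of_real lam * of_real t) powr of_real (1 / lam) =
      complex_of_real ((1 + lam * t) powr (1 / lam))"
    using powr_of_real[of "1 + lam * t" "1 / lam"] pos by simp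
  also have "exp (of_real \<alpha> * (\<dots> - 1)) = of_real (exp (\<alpha> * (degenerate_exp lam 1 t - 1)))"
    using pos by (simp add: degenerate_exp_def real_power_eq_powr flip: exp_of_real)
  finally show ?thesis by (simp only: sums_of_real_iff)
qed

section \<open>Moments from limits at 1\<close>

text \<open>A converse of Abel's theorem, elementary for nonnegative coefficients: partial sums at
  \<open>s\<close> stay below \<open>f s\<close>, so partial sums at 1 stay below \<open>L\<close>;
  conversely \<open>f s\<close> stays below the sum of \<open>c\<close>.\<close>

lemma sums_if_tendsto_at_left_1:
  fixes c :: "nat \<Rightarrow> real"
  assumes "\<And>n. c n \<ge> 0"
    and sums: "\<And>s. s \<in> {0<..<1} \<Longrightarrow> (\<lambda>n. c n * s ^ n) sums f s"
    and lim: "(f \<longlongrightarrow> L) (at_left 1)"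
  shows "c sums L"
proof -
  have ev: "eventually (\<lambda>s::real. s \<in> {0<..<1}) (at_left 1)"
    by (rule eventually_at_left_real) simp
  have le: "sum c {..<n} \<le> L" for n
  proof (rule tendsto_le[OF _ lim])
    have "((\<lambda>s. \<Sum>i<n. c i * s ^ i) \<longlongrightarrow> (\<Sum>i<n. c i * 1 ^ i)) (at_left 1)"
      by (intro tendsto_intros)
    then show "((\<lambda>s. \<Sum>i<n. c i * s ^ i) \<longlongrightarrow> sum c {..<n}) (at_left 1)" by simp
    show "\<forall>\<^sub>F s in at_left 1. (\<Sum>i<n. c i * s ^ i) \<le> f s"
      using ev
    proof eventually_elim
      case (elim s)
      have "summable (\<lambda>i. c i * s ^ i)" "(\<Sum>i. c i * s ^ i) = f s"
        using sums[OF elim] by (simp_all add: sums_iff)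
      moreover have "0 \<le> c i * s ^ i" for i
        using assms(1) elim by simp
      ultimately show ?case
        using sum_le_suminf[of "\<lambda>i. c i * s ^ i" "{..<n}"] by simp
    qed
  qed simp
  then have summ: "summable c"
    using assms(1) by (intro summableI_nonneg_bounded)
  have "L \<le> suminf c"
  proof (rule tendsto_upperbound[OF lim])
    show "\<forall>\<^sub>F s in at_left 1. f s \<le> suminf c"
      using ev
    proof eventually_elim
      case (elim s)
      have "c n * s ^ n \<le> c n" for n
        using elim assms(1)[of n] by (intro mult_left_le power_le_one) auto
      then show ?case using sums_le[OF _ sums[OF elim] summable_sums[OF summ]] by simp
    qed
  qed simp
  moreover have "suminf c \<le> L"
    using summ le by (rule suminf_le_const)
  ultimately show ?thesis using summ by (simp add: sums_iff)
qed

lemma diffs_sums_deriv: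
  fixes c :: "nat \<Rightarrow> real"
  assumes sums: "\<And>s. s \<in> {0<..<1} \<Longrightarrow> (\<lambda>n. c n * s ^ n) sums f s"
    and deriv: "(f has_real_derivative D) (at s)" and s: "s \<in> {0<..<1}"
  shows "(\<lambda>n. diffs c n * s ^ n) sums D"
proof -
  \<comment> \<open>The midpoint of \<open>s\<close> and 1 is a point of convergence strictly beyond
    \<open>s\<close>, as termwise differentiation requires.\<close>
  define K where "K = (s + 1) / 2"
  have K: "K \<in> {0<..<1}" "norm s < norm K" using s by (auto simp: K_def)
  have summ: "summable (\<lambda>n. c n * K ^ n)" using sums[OF K(1)] by (simp add: sums_iff)
  have "summable (\<lambda>n. diffs c n * s ^ n)"
  proof (rule termdiff_converges[of s "norm K"])
    show "summable (\<lambda>n. c n * x ^ n)" if "norm x < norm K" for x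
      using powser_inside[OF summ that] .
  qed (fact K)
  moreover have "(f has_real_derivative (\<Sum>n. diffs c n * s ^ n)) (at s)"
  proof (rule DERIV_cong_ev[THEN iffD1, OF refl _ refl termdiffs_strong[OF summ K(2)]])
    have "eventually (\<lambda>x. x \<in> {0<..<1}) (nhds s)"
      using s by (intro eventually_nhds_in_open) auto
    then show "\<forall>\<^sub>F x in nhds s. (\<Sum>n. c n * x ^ n) = f x"
      by eventually_elim (use sums in \<open>simp add: sums_iff\<close>)
  qed
  ultimately show ?thesis
    using DERIV_unique[OF deriv] by (simp add: sums_iff)
qed

text \<open>The law of \<open>X\<close> is a density with respect to counting measure, so
  expectations become series. The second moment is the second factorial moment plus the
  mean.\<close>

lemma (in prob_space) nat_variable_moments:
  fixes X :: "'a \<Rightarrow> nat"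
  assumes X [measurable]: "X \<in> measurable M (count_space UNIV)"
    and mean: "(\<lambda>k. real k * prob {\<omega> \<in> space M. X \<omega> = k}) sums L1"
    and fact2: "(\<lambda>k. real k * (real k - 1) * prob {\<omega> \<in> space M. X \<omega> = k}) sums L2"
  shows "integrable M (\<lambda>\<omega>. real (X \<omega>))" "integrable M (\<lambda>\<omega>. (real (X \<omega>))\<^sup>2)"
    "expectation (\<lambda>\<omega>. real (X \<omega>)) = L1" "variance (\<lambda>\<omega>. real (X \<omega>)) = L2 + L1 - L1\<^sup>2"
proof -
  define p where "p k = prob {\<omega> \<in> space M. X \<omega> = k}" for k
  let ?D = "distr M (count_space UNIV) X"
  have D: "?D = density (count_space UNIV) p"
  proof (rule measure_eqI_countable[where A = UNIV])
    fix k :: nat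
    have "emeasure ?D {k} = emeasure M {\<omega> \<in> space M. X \<omega> = k}"
      by (subst emeasure_distr) (auto intro!: arg_cong[where f = "emeasure M"])
    then show "emeasure ?D {k} = emeasure (density (count_space UNIV) p) {k}"
      by (simp add: emeasure_density p_def emeasure_eq_measure)
  qed auto
  \<comment> \<open>For nonnegative \<open>g\<close> convergence of the series is absolute and hence
    yields integrability.\<close>
  have moment: "integrable M (\<lambda>\<omega>. g (X \<omega>)) \<and> expectation (\<lambda>\<omega>. g (X \<omega>)) = L"
    if "\<And>k. g k \<ge> 0" "(\<lambda>k. g k * p k) sums L" for g :: "nat \<Rightarrow> real" and L
  proof -
    have p: "p k \<ge> 0" for k by (simp add: p_def)
    have int: "integrable (count_space UNIV) (\<lambda>k. p k *\<^sub>R g k)"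
      using that p by (simp add: integrable_count_space_nat_iff abs_mult mult.commute sums_iff)
    then have "integrable ?D g"
      unfolding D using p by (subst integrable_density) auto
    moreover have "integral\<^sup>L ?D g = L"
      unfolding D using p that(2) int
      by (subst integral_density) (auto simp: integral_count_space_nat sums_iff mult.commute)
    ultimately show ?thesis
      by (subst (asm) integrable_distr_eq, simp, simp) (subst (asm) integral_distr, auto)
  qed
  have int: "integrable M (\<lambda>\<omega>. real (X \<omega>))" and E: "expectation (\<lambda>\<omega>. real (X \<omega>)) = L1"
    using moment[of real L1] mean by (auto simp: p_def)
  have "(\<lambda>k. real k * (real k - 1) * p k + real k * p k) sums (L2 + L1)"
    using mean fact2 unfolding p_def by (intro sums_add)
  then have "(\<lambda>k. (real k)\<^sup>2 * p k) sums (L2 + L1)"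
    by (simp add: algebra_simps power2_eq_square)
  then have int2: "integrable M (\<lambda>\<omega>. (real (X \<omega>))\<^sup>2)"
      and E2: "expectation (\<lambda>\<omega>. (real (X \<omega>))\<^sup>2) = L2 + L1"
    using moment[of "\<lambda>k. (real k)\<^sup>2" "L2 + L1"] by auto
  show "integrable M (\<lambda>\<omega>. real (X \<omega>))" "integrable M (\<lambda>\<omega>. (real (X \<omega>))\<^sup>2)"
    "expectation (\<lambda>\<omega>. real (X \<omega>)) = L1"
    by fact+
  show "variance (\<lambda>\<omega>. real (X \<omega>)) = L2 + L1 - L1\<^sup>2"
    using int int2 by (subst variance_eq) (simp_all add: E E2)
qed

section \<open>Calculus of the degenerate exponential\<close>

text \<open>The positive exponent excludes the one exceptional value,
  \<open>0 powi 0 = 1\<close>.\<close>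

lemma degenerate_exp_eq_0:
  assumes "lam > 0" and "x > 0" and "1 + lam * t = 0"
  shows "degenerate_exp lam x t = 0"
proof -
  have "x / lam > 0" using assms by simp
  then have "\<lfloor>x / lam\<rfloor> \<noteq> 0" if "x / lam \<in> \<int>"
    using that by (metis Ints_cases floor_of_int of_int_0 less_irrefl)
  then show ?thesis
    using assms(3) by (simp add: degenerate_exp_def real_power_def power_int_0_left_if)
qed

lemma has_real_derivative_degenerate_exp:
  assumes "lam > 0" and "1 + lam * t > 0 \<or> x / lam \<in> \<nat>"
  shows "(degenerate_exp lam x has_real_derivative x * degenerate_exp lam (x - lam) t) (at t)"
  using assms(2)
proof
  assume "x / lam \<in> \<nat>"
  then obtain n where "x / lam = real n" by (elim Nats_cases)
  then have x: "x = real n * lam" using assms(1) by (simp add: field_simps)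
  have fn: "degenerate_exp lam (real n * lam) = (\<lambda>t. (1 + lam * t) ^ n)" for n
    using assms(1) by (simp add: degenerate_exp_def fun_eq_iff)
  show ?thesis
  proof (cases n)
    case 0
    \<comment> \<open>The function is constant and the factor \<open>x\<close> is 0, whatever value
      the exponent -1 gives.\<close>
    then show ?thesis using fn[of 0] x by simp
  next
    case (Suc m)
    have "x - lam = real m * lam" using x Suc by (simp add: algebra_simps)
    then have "degenerate_exp lam (x - lam) t = (1 + lam * t) ^ m" by (simp add: fn)
    have "((\<lambda>t. (1 + lam * t) ^ n) has_real_derivative real n * (1 + lam * t) ^ (n - 1) * lam) (at t)"
      by (auto intro!: derivative_eq_intros)
    with \<open>degenerate_exp lam (x - lam) t = _\<close> show ?thesis
      unfolding x fn using Suc by (simp add: mult_ac)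
  qed
next
  assume *: "1 + lam * t > 0"
  have "eventually (\<lambda>t. t \<in> {t. 1 + lam * t > 0}) (nhds t)"
    using * by (intro eventually_nhds_in_open open_Collect_less continuous_intros) auto
  then have ev: "\<forall>\<^sub>F t in nhds t. (1 + lam * t) powr (x / lam) = degenerate_exp lam x t"
    by eventually_elim (simp add: degenerate_exp_def real_power_eq_powr)
  have "((\<lambda>t. (1 + lam * t) powr (x / lam)) has_real_derivative
      (x / lam) * (1 + lam * t) powr (x / lam - 1) * lam) (at t)"
    by (rule DERIV_chain2[where f = "\<lambda>z. z powr (x / lam)" and g = "\<lambda>t. 1 + lam * t", OF has_real_derivative_powr[OF *, of "x / lam"]])
      (auto intro!: derivative_eq_intros)
  moreover have "(x / lam) * (1 + lam * t) powr (x / lam - 1) * lam = x * degenerate_exp lam (x - lam) t"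
    using * assms(1) by (simp add: degenerate_exp_def real_power_eq_powr diff_divide_distrib)
  ultimately show ?thesis
    by (simp add: DERIV_cong_ev[OF refl ev refl])
qed

lemma isCont_degenerate_exp:
  assumes "lam > 0" and "1 + lam * t > 0 \<or> 1 + lam * t \<noteq> 0 \<and> x / lam \<in> \<int>"
  shows "isCont (degenerate_exp lam x) t"
  using assms(2)
proof
  assume "1 + lam * t > 0"
  with has_real_derivative_degenerate_exp[OF assms(1)] show ?thesis
    by (blast intro: DERIV_isCont)
next
  assume "1 + lam * t \<noteq> 0 \<and> x / lam \<in> \<int>"
  then have "degenerate_exp lam x = (\<lambda>t. (1 + lam * t) powi \<lfloor>x / lam\<rfloor>)" "1 + lam * t \<noteq> 0"
    by (auto simp: degenerate_exp_def real_power_def fun_eq_iff)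
  then show ?thesis unfolding isCont_def by (auto intro!: tendsto_intros)
qed

text \<open>The base must be nonzero: \<open>0 powi (- 1) * 0 powi 1\<close> is 0, but
  \<open>0 powi 0\<close> is 1.\<close>

lemma degenerate_exp_add:
  assumes "lam > 0" and "1 + lam * t > 0 \<or> 1 + lam * t \<noteq> 0 \<and> x / lam \<in> \<int> \<and> y / lam \<in> \<int>"
  shows "degenerate_exp lam (x + y) t = degenerate_exp lam x t * degenerate_exp lam y t"
  using assms(2)
proof
  assume "1 + lam * t > 0"
  then show ?thesis by (simp add: degenerate_exp_def real_power_eq_powr add_divide_distrib powr_add)
next
  assume "1 + lam * t \<noteq> 0 \<and> x / lam \<in> \<int> \<and> y / lam \<in> \<int>"
  then show ?thesis
    by (auto simp: degenerate_exp_def real_power_def add_divide_distrib power_int_add elim!: Ints_cases)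
qed

section \<open>Convergence beyond the radius \<open>1 / lam\<close>\<close>

text \<open>The closed form is known only inside the disc of radius \<open>1 / lam\<close>, so the
  zero order at the boundary point \<open>z0\<close> is read off along the real segment that ends
  there.\<close>

lemma summable_bell_fps_imp_Nats:
  assumes lam: "lam > 0" and "\<alpha> \<noteq> 0" and summ: "summable (\<lambda>n. fps_nth (bell_fps lam \<alpha>) n * \<theta> ^ n)"
    and \<theta>: "\<bar>lam * \<theta>\<bar> > 1"
  shows "1 / lam \<in> \<nat>"
proof -
  define F where "F = fps_of_real (bell_fps lam \<alpha>)"
  define G where "G = eval_fps F"
  define z0 :: complex where "z0 = of_real (- 1 / lam)"
  have "summable (\<lambda>n. complex_of_real (fps_nth (bell_fps lam \<alpha>) n * \<theta> ^ n))"
    using summ by (rule summable_of_real)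
  then have "summable (\<lambda>n. fps_nth F n * of_real \<theta> ^ n)"
    by (simp add: F_def)
  from conv_radius_geI[OF this] have radius: "fps_conv_radius F \<ge> \<bar>\<theta>\<bar>"
    by (simp add: fps_conv_radius_def)
  have holG: "G holomorphic_on ball 0 \<bar>\<theta>\<bar>"
    unfolding G_def
  proof (rule holomorphic_on_eval_fps)
    show "ball (0 :: complex) \<bar>\<theta>\<bar> \<subseteq> eball 0 (fps_conv_radius F)"
    proof
      fix z :: complex assume "z \<in> ball 0 \<bar>\<theta>\<bar>"
      then have "ereal (norm z) < ereal \<bar>\<theta>\<bar>" by simp
      also note radius
      finally show "z \<in> eball 0 (fps_conv_radius F)" by (simp add: in_eball_iff)
    qed
  qed
  have z0: "z0 \<in> ball 0 \<bar>\<theta>\<bar>"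
    using \<theta> lam by (simp add: z0_def norm_divide abs_mult field_simps)
  have G_eq: "G z = exp (of_real \<alpha> * ((1 + of_real lam * z) powr of_real (1 / lam) - 1))"
    if "norm (of_real lam * z) < 1" for z
    using bell_fps_sums_complex[OF lam that, of \<alpha>]
    by (simp add: G_def F_def eval_fps_def sums_iff)
  \<comment> \<open>Approach the singularity \<open>z0\<close> along the real axis from the right, where the sum is known.\<close>
  define path where "path s = z0 + complex_of_real s" for s
  have path: "1 + of_real lam * path s = of_real (lam * s)"
      "norm (of_real lam * path s) < 1" if "s \<in> {0<..<1/lam}" for s
  proof -
    have eq: "of_real lam * path s = of_real (lam * s - 1)"
      using lam by (simp add: path_def z0_def algebra_simps)
    show "1 + of_real lam * path s = of_real (lam * s)" by (subst eq) simp
    have "\<bar>lam * s - 1\<bar> < 1" using that lam by (auto simp: abs_less_iff field_simps)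
    then show "norm (of_real lam * path s) < 1" unfolding eq norm_of_real .
  qed
  have path_tendsto: "(path \<longlongrightarrow> z0) (at_right 0)"
    unfolding path_def by (auto intro!: tendsto_eq_intros)
  have ev: "eventually (\<lambda>s. s \<in> {0<..<1/lam}) (at_right 0)"
    using lam by (intro eventually_at_right_real) simp
  have contG: "isCont G z0"
    using holG z0 by (meson holomorphic_on_imp_continuous_on continuous_on_eq_continuous_at open_ball)
  \<comment> \<open>The limit \<open>exp (- \<alpha>)\<close> is the value of \<open>G\<close> at
    \<open>z0\<close>. It is nonzero, so the logarithmic derivative is holomorphic near
    \<open>z0\<close>.\<close>
  have "((\<lambda>s. G (path s)) \<longlongrightarrow> exp (of_real \<alpha> * (of_real 0 - 1))) (at_right 0)"
  proof (rule Lim_transform_eventually)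
    have "((\<lambda>s. (lam * s) powr (1 / lam)) \<longlongrightarrow> (lam * 0) powr (1 / lam)) (at_right 0)"
      using lam by (intro tendsto_powr' tendsto_intros) (auto simp: eventually_at_filter)
    then have "((\<lambda>s. (lam * s) powr (1 / lam)) \<longlongrightarrow> 0) (at_right 0)" by simp
    then show "((\<lambda>s. exp (of_real \<alpha> * (complex_of_real ((lam * s) powr (1 / lam)) - 1))) \<longlongrightarrow>
        exp (of_real \<alpha> * (of_real 0 - 1))) (at_right 0)"
      by (intro tendsto_intros)
    show "\<forall>\<^sub>F s in at_right 0. exp (of_real \<alpha> * (complex_of_real ((lam * s) powr (1 / lam)) - 1)) = G (path s)"
      using ev
    proof eventually_elim
      case (elim s)
      have "complex_of_real (lam * s) powr of_real (1 / lam) = of_real ((lam * s) powr (1 / lam))"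
        using elim lam by (intro powr_of_real) auto
      then show ?case using G_eq[OF path(2)[OF elim]] path(1)[OF elim] by simp
    qed
  qed
  moreover have "((\<lambda>s. G (path s)) \<longlongrightarrow> G z0) (at_right 0)"
    using isCont_tendsto_compose[OF contG path_tendsto] .
  ultimately have "G z0 \<noteq> 0"
    using tendsto_unique[OF trivial_limit_at_right_real] by (metis exp_not_eq_zero)
  moreover have contG': "continuous_on (ball 0 \<bar>\<theta>\<bar>) G"
    using holG by (rule holomorphic_on_imp_continuous_on)
  ultimately obtain e where e: "e > 0" "\<And>y. dist z0 y < e \<Longrightarrow> y \<in> ball 0 \<bar>\<theta>\<bar> \<Longrightarrow> G y \<noteq> 0"
    using continuous_on_avoid[OF contG' z0, of 0] by blast
  obtain d where d: "d > 0" "ball z0 d \<subseteq> ball 0 \<bar>\<theta>\<bar>"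
    using z0 open_contains_ball by (metis open_ball)
  define S where "S = ball z0 (min d e)"
  have S: "open S" "connected S" "z0 \<in> S" "S \<subseteq> ball 0 \<bar>\<theta>\<bar>" "\<And>y. y \<in> S \<Longrightarrow> G y \<noteq> 0"
    using d e by (auto simp: S_def)
  define K where "K z = deriv G z / G z" for z
  have holK: "K holomorphic_on S"
    unfolding K_def using S holG
    by (intro holomorphic_intros holomorphic_deriv) (auto intro: holomorphic_on_subset)
  \<comment> \<open>Dividing by \<open>G\<close> cancels the exponential and leaves a pure real
    power.\<close>
  have K_path: "K (path s) = of_real (\<alpha> * (lam * s) powr (1 / lam - 1))" if s: "s \<in> {0<..<1/lam}" for s
  proof -
    have pos: "lam * s > 0" using that lam by simp
    have "(G has_field_derivative of_real \<alpha> * (of_real (1 / lam) *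
       (1 + of_real lam * path s) powr (of_real (1 / lam) - 1) * of_real lam) * G (path s)) (at (path s))"
    proof (rule DERIV_cong_ev[THEN iffD2, OF refl _ refl])
      have "open {z. norm (complex_of_real lam * z) < 1}"
        by (intro open_Collect_less continuous_intros)
      then have "eventually (\<lambda>z. z \<in> {z. norm (complex_of_real lam * z) < 1}) (nhds (path s))"
        using path(2)[OF s] by (intro eventually_nhds_in_open) auto
      then show "\<forall>\<^sub>F z in nhds (path s). G z =
          exp (of_real \<alpha> * ((1 + of_real lam * z) powr of_real (1 / lam) - 1))"
        by eventually_elim (simp add: G_eq)
      show "((\<lambda>z. exp (of_real \<alpha> * ((1 + of_real lam * z) powr of_real (1 / lam) - 1)))
        has_field_derivative of_real \<alpha> * (of_real (1 / lam) *
          (1 + of_real lam * path s) powr (of_real (1 / lam) - 1) * of_real lam) * G (path s)) (at (path s))"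
        unfolding G_eq[OF path(2)[OF s]]
        by (rule derivative_eq_intros refl one_plus_notin_nonpos_Reals[OF path(2)[OF s]])+ simp
    qed
    then have "deriv G (path s) = of_real \<alpha> * (of_real (1 / lam) *
       (1 + of_real lam * path s) powr (of_real (1 / lam) - 1) * of_real lam) * G (path s)"
      by (rule DERIV_imp_deriv)
    moreover have "G (path s) \<noteq> 0" using G_eq[OF path(2)[OF s]] by simp
    ultimately have "K (path s) = of_real \<alpha> * (1 + of_real lam * path s) powr of_real (1 / lam - 1)"
      using lam by (simp add: K_def)
    also have "(1 + of_real lam * path s) powr of_real (1 / lam - 1) = of_real ((lam * s) powr (1 / lam - 1))"
      unfolding path(1)[OF s] using pos by (intro powr_of_real) auto
    finally show ?thesis by simp
  qed
  have path_in: "\<forall>\<^sub>F s in at_right 0. path s \<in> U" if "open U" "z0 \<in> U" for U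
    using topological_tendstoD[OF path_tendsto that] .
  \<comment> \<open>Factoring out the zero at \<open>z0\<close> requires that \<open>K\<close> does
    not vanish identically.\<close>
  have "\<exists>w\<in>S. K w \<noteq> 0"
  proof -
    have "\<forall>\<^sub>F s in at_right 0. path s \<in> S \<and> K (path s) \<noteq> 0"
      using path_in[OF S(1,3)] ev
    proof eventually_elim
      case (elim s)
      then show ?case using K_path[OF elim(2)] lam \<open>\<alpha> \<noteq> 0\<close> by simp
    qed
    then show ?thesis
      using eventually_happens'[OF trivial_limit_at_right_real] by blast
  qed
  from zorder_exist_zero[OF holK S(1-3) this] obtain r g n where r: "r > 0"
      and g: "g holomorphic_on cball z0 r" "\<And>w. w \<in> cball z0 r \<Longrightarrow> K w = g w * (w - z0) ^ n \<and> g w \<noteq> 0"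
    by blast
  define \<beta> where "\<beta> = 1 / lam - 1"
  have "isCont g z0"
    using g(1) r by (meson ball_subset_cball centre_in_ball continuous_on_eq_continuous_at
        holomorphic_on_imp_continuous_on holomorphic_on_subset open_ball)
  from isCont_tendsto_compose[OF this path_tendsto]
  have lim: "((\<lambda>s. norm (g (path s))) \<longlongrightarrow> norm (g z0)) (at_right 0)"
    by (rule tendsto_norm)
  \<comment> \<open>Equates the norms of the two forms of \<open>K\<close> on the path, where
    \<open>w - z0\<close> is \<open>s\<close>.\<close>
  have g_path: "\<forall>\<^sub>F s in at_right 0. norm (g (path s)) = \<bar>\<alpha>\<bar> * lam powr \<beta> * s powr (\<beta> - n)"
    using path_in[OF open_ball centre_in_ball[THEN iffD2, OF r]] ev
  proof eventually_elim
    case (elim s)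
    then have s: "s > 0" by simp
    from elim have "K (path s) = g (path s) * of_real s ^ n" using g(2) by (simp add: path_def)
    then have "norm (g (path s) * of_real s ^ n) = norm (of_real (\<alpha> * (lam * s) powr \<beta>) :: complex)"
      using K_path[OF elim(2)] by (simp add: \<beta>_def)
    then have "norm (g (path s)) * s powr n = \<bar>\<alpha>\<bar> * (lam * s) powr \<beta>"
      unfolding norm_of_real norm_mult norm_power abs_mult using s by (simp add: powr_realpow)
    then show ?case using s lam by (simp add: powr_mult powr_diff field_simps)
  qed
  \<comment> \<open>A larger \<beta> would force \<open>g z0 = 0\<close>; a smaller one would force
    \<open>\<alpha> = 0\<close>.\<close>
  have "\<beta> = n"
  proof (rule ccontr)
    assume "\<beta> \<noteq> n"
    then consider "\<beta> > n" | "\<beta> < n" by linarith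
    then show False
    proof cases
      case 1
      have "((\<lambda>s. \<bar>\<alpha>\<bar> * lam powr \<beta> * s powr (\<beta> - n)) \<longlongrightarrow> \<bar>\<alpha>\<bar> * lam powr \<beta> * 0 powr (\<beta> - n)) (at_right 0)"
        using 1 by (intro tendsto_powr' tendsto_intros) (auto simp: eventually_at_filter)
      then have "((\<lambda>s. norm (g (path s))) \<longlongrightarrow> 0) (at_right 0)"
        using g_path by (simp add: filterlim_cong)
      from tendsto_unique[OF trivial_limit_at_right_real this lim] show False
        using g(2)[of z0] r by simp
    next
      case 2
      have "((\<lambda>s. norm (g (path s)) * s powr (n - \<beta>)) \<longlongrightarrow> norm (g z0) * 0 powr (n - \<beta>)) (at_right 0)"
        using 2 by (intro tendsto_powr' tendsto_intros lim) (auto simp: eventually_at_filter)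
      then have "((\<lambda>s. norm (g (path s)) * s powr (n - \<beta>)) \<longlongrightarrow> 0) (at_right 0)" by simp
      moreover have "\<forall>\<^sub>F s in at_right 0. norm (g (path s)) * s powr (n - \<beta>) = \<bar>\<alpha>\<bar> * lam powr \<beta>"
        using g_path ev by eventually_elim (simp add: mult.assoc flip: powr_add)
      ultimately have "((\<lambda>s. \<bar>\<alpha>\<bar> * lam powr \<beta>) \<longlongrightarrow> 0) (at_right (0::real))"
        by (simp add: filterlim_cong)
      with tendsto_unique[OF trivial_limit_at_right_real this tendsto_const] show False
        using lam \<open>\<alpha> \<noteq> 0\<close> by simp
    qed
  qed
  then have "1 / lam = real (Suc n)" by (simp add: \<beta>_def)
  then show ?thesis by (metis of_nat_in_Nats)
qed

section \<open>Limits of the generating function at 1, and the moments\<close>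

text \<open>Differentiability gives continuity except at the endpoint
  \<open>lam * \<theta> = -1\<close>. There the base is \<open>1 - s\<close>, and a positive
  exponent still gives the limit 0.\<close>

lemma degenerate_exp_tendsto_at_left_1:
  assumes lam: "lam > 0"
    and reg: "\<bar>lam * \<theta>\<bar> \<le> 1 \<and> (1 + lam * \<theta> > 0 \<or> x > 0) \<or> x / lam \<in> \<nat>"
  shows "((\<lambda>s. degenerate_exp lam x (\<theta> * s)) \<longlongrightarrow> degenerate_exp lam x \<theta>) (at_left 1)"
proof (cases "1 + lam * \<theta> > 0 \<or> x / lam \<in> \<nat>")
  case True
  then have "isCont (degenerate_exp lam x) \<theta>"
    using has_real_derivative_degenerate_exp[OF lam] by (blast intro: DERIV_isCont)
  then show ?thesis
    by (rule isCont_tendsto_compose) (auto intro!: tendsto_eq_intros)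
next
  case False
  with reg have \<theta>: "lam * \<theta> = -1" and x: "x > 0" by auto
  have eq: "1 + lam * (\<theta> * s) = 1 - s" for s
    using \<theta> by (simp flip: mult.assoc)
  have "((\<lambda>s. (1 - s) powr (x / lam)) \<longlongrightarrow> (1 - 1) powr (x / lam)) (at_left 1)"
    using x lam by (intro tendsto_powr' tendsto_intros) (auto simp: eventually_at_filter)
  moreover have "degenerate_exp lam x \<theta> = 0"
    using x lam \<theta> by (intro degenerate_exp_eq_0) auto
  moreover have "\<forall>\<^sub>F s in at_left 1. (1 - s) powr (x / lam) = degenerate_exp lam x (\<theta> * s)"
    using eventually_at_left_real[of 0 1, simplified]
    by eventually_elim (simp add: degenerate_exp_def eq real_power_eq_powr)
  ultimately show ?thesis
    by (auto elim: Lim_transform_eventually)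
qed

lemma (in prob_space) sums_prob_nat_variable:
  fixes X :: "'a \<Rightarrow> nat"
  assumes [measurable]: "X \<in> measurable M (count_space UNIV)"
  shows "(\<lambda>k. prob {\<omega> \<in> space M. X \<omega> = k}) sums 1"
proof -
  have "(\<lambda>k. prob {\<omega> \<in> space M. X \<omega> = k}) sums prob (\<Union>k. {\<omega> \<in> space M. X \<omega> = k})"
    by (intro finite_measure_UNION) (auto simp: disjoint_family_on_def)
  also have "(\<Union>k. {\<omega> \<in> space M. X \<omega> = k}) = space M" by auto
  finally show ?thesis by (simp add: prob_space)
qed

text \<open>The term at \<open>k = 0\<close> vanishes, so the index shift in \<open>diffs\<close>
  keeps the sum.\<close>

lemma diffs_sums_iff:
  fixes p :: "nat \<Rightarrow> real"
  shows "diffs p sums L \<longleftrightarrow> (\<lambda>k. real k * p k) sums L"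
  using sums_Suc_iff[of "\<lambda>k. real k * p k" L] by (simp add: diffs_def)

lemma diffs_diffs_sums_iff:
  fixes p :: "nat \<Rightarrow> real"
  shows "diffs (diffs p) sums L \<longleftrightarrow> (\<lambda>k. real k * (real k - 1) * p k) sums L"
proof -
  have "diffs (diffs p) sums L \<longleftrightarrow> (\<lambda>k. real k * diffs p k) sums L"
    by (rule diffs_sums_iff)
  also have "(\<lambda>k. real k * diffs p k) = (\<lambda>k. real (Suc k) * (real (Suc k) - 1) * p (Suc k))"
    by (simp add: diffs_def fun_eq_iff)
  also have "\<dots> sums L \<longleftrightarrow> (\<lambda>k. real k * (real k - 1) * p k) sums L"
    using sums_Suc_iff[of "\<lambda>k. real k * (real k - 1) * p k" L] by simp
  finally show ?thesis .
qed

theorem theorem4: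
  fixes M :: "'a measure" and X :: "'a \<Rightarrow> nat" and lam \<alpha> \<theta> :: real
  assumes "prob_space M"
    and "0 < lam" and "lam \<le> 1"
    and "has_degenerate_bell_distribution M X lam \<alpha> \<theta>"
  shows "integrable M (\<lambda>\<omega>. real (X \<omega>)) \<and>
      integrable M (\<lambda>\<omega>. (real (X \<omega>))\<^sup>2) \<and>
      prob_space.expectation M (\<lambda>\<omega>. real (X \<omega>)) = \<theta> * \<alpha> * degenerate_exp lam (1 - lam) \<theta> \<and>
      prob_space.variance M (\<lambda>\<omega>. real (X \<omega>)) =
           \<theta> * \<alpha> * (1 + \<theta> * (1 - lam) * degenerate_exp lam (- lam) \<theta>) *
             degenerate_exp lam (1 - lam) \<theta>"
proof -
  interpret prob_space M by fact
  note lam = \<open>0 < lam\<close>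
  let ?E = "degenerate_exp lam"
  define p where "p k = prob {\<omega> \<in> space M. X \<omega> = k}" for k
  define C where "C = exp (- \<alpha> * (?E 1 \<theta> - 1))"
  define L1 where "L1 = \<alpha> * \<theta> * ?E (1 - lam) \<theta>"
  \<comment> \<open>\<open>V + L1\<^sup>2\<close> will be the second factorial moment, so the
    variance is \<open>V + L1\<close>.\<close>
  define V where "V = \<alpha> * \<theta>\<^sup>2 * (1 - lam) * (?E (- lam) \<theta> * ?E (1 - lam) \<theta>)"
  have X: "X \<in> measurable M (count_space UNIV)"
    and p: "p k = C * (fps_nth (bell_fps lam \<alpha>) k * \<theta> ^ k)" for k
    using assms(4)
    by (auto simp: has_degenerate_bell_distribution_def p_def C_def degenerate_bell_def bell_fps_def)
  have p_nonneg: "p k \<ge> 0" for k by (simp add: p_def)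
  have C: "C > 0" by (simp add: C_def)
  have p_sums: "p sums 1"
    using sums_prob_nat_variable[OF X] by (simp add: p_def[abs_def])
  have "(\<lambda>k. real k * p k) sums L1 \<and> (\<lambda>k. real k * (real k - 1) * p k) sums (V + L1\<^sup>2)"
  proof (cases "\<alpha> = 0")
    \<comment> \<open>Here all the mass sits at 0.\<close>
    case True
    then have "p k = 0" if "k > 0" for k
      using that by (simp add: p bell_fps_def)
    then have zero: "real k * p k = 0" for k by (cases k) auto
    have zero2: "real k * (real k - 1) * p k = 0" for k using zero[of k] by auto
    show ?thesis unfolding zero zero2 by (simp add: L1_def V_def True)
  next
    case False
    have "summable (\<lambda>k. fps_nth (bell_fps lam \<alpha>) k * \<theta> ^ k)"
      using sums_summable[OF p_sums] C by (simp add: p[THEN ext] summable_cmult_iff)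
    from summable_bell_fps_imp_Nats[OF lam False this]
    have reg: "\<bar>lam * \<theta>\<bar> \<le> 1 \<or> 1 / lam \<in> \<nat>" by linarith
    have Nats: "(1 - lam) / lam \<in> \<nat>" if "1 / lam \<in> \<nat>"
    proof -
      from that obtain m where m: "1 / lam = real m" by (elim Nats_cases)
      with lam have "m \<noteq> 0" by (intro notI) auto
      then have "(1 - lam) / lam = real (m - 1)" using m lam by (simp add: diff_divide_distrib of_nat_diff)
      then show ?thesis by (metis of_nat_in_Nats)
    qed
    \<comment> \<open>\<open>h\<close> is the probability generating function, \<open>D1\<close> its
      logarithmic derivative and \<open>D2\<close> the derivative of \<open>D1\<close>. Hence
      \<open>h' = D1 * h\<close> and \<open>h'' = (D2 + D1\<^sup>2) * h\<close>.\<close>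
    define h where "h s = C * exp (\<alpha> * (?E 1 (\<theta> * s) - 1))" for s
    define D1 where "D1 s = \<alpha> * \<theta> * ?E (1 - lam) (\<theta> * s)" for s
    define D2 where "D2 s = \<alpha> * \<theta>\<^sup>2 * ((1 - lam) * ?E (1 - 2 * lam) (\<theta> * s))" for s
    \<comment> \<open>Scaling by \<open>s < 1\<close> moves the boundary case
      \<open>\<bar>lam * \<theta>\<bar> = 1\<close> into the open disc.\<close>
    have inner: "\<bar>lam * (\<theta> * s)\<bar> < 1 \<or> 1 / lam \<in> \<nat>" if "s \<in> {0<..<1}" for s
    proof (cases "1 / lam \<in> \<nat>")
      case False
      have "\<bar>lam * (\<theta> * s)\<bar> = \<bar>lam * \<theta>\<bar> * s" using that by (simp add: abs_mult)
      also have "\<dots> \<le> 1 * s" using reg False that by (intro mult_right_mono) auto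
      finally show ?thesis using that by simp
    qed simp
    have h_sums: "(\<lambda>n. p n * s ^ n) sums h s" if "s \<in> {0<..<1}" for s
      using sums_mult[OF bell_fps_sums[OF lam inner[OF that], of \<alpha>], of C]
      by (simp add: p h_def power_mult_distrib mult_ac)
    have deriv_E: "((\<lambda>s. ?E x (\<theta> * s)) has_real_derivative x * ?E (x - lam) (\<theta> * s) * \<theta>) (at s)"
      if "s \<in> {0<..<1}" "x = 1 \<or> x = 1 - lam" for s x
    proof (rule DERIV_chain2[where f = "?E x"])
      show "(?E x has_real_derivative x * ?E (x - lam) (\<theta> * s)) (at (\<theta> * s))"
        using inner[OF that(1)] that(2) Nats by (intro has_real_derivative_degenerate_exp[OF lam]) auto
    qed (auto intro!: derivative_eq_intros)
    have deriv_h: "(h has_real_derivative D1 s * h s) (at s)" if "s \<in> {0<..<1}" for s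
      unfolding h_def D1_def
      by (rule derivative_eq_intros refl deriv_E[OF that])+ auto
    have deriv_D1: "(D1 has_real_derivative D2 s) (at s)" if "s \<in> {0<..<1}" for s
      unfolding D1_def D2_def
      by (rule derivative_eq_intros refl deriv_E[OF that])+ (auto simp: power2_eq_square)
    have h1_sums: "(\<lambda>n. diffs p n * s ^ n) sums (D1 s * h s)" if "s \<in> {0<..<1}" for s
      using diffs_sums_deriv[OF h_sums deriv_h[OF that] that] .
    have h2_sums: "(\<lambda>n. diffs (diffs p) n * s ^ n) sums ((D2 s + (D1 s)\<^sup>2) * h s)"
      if s: "s \<in> {0<..<1}" for s
    proof (rule diffs_sums_deriv[OF h1_sums _ s])
      have "((\<lambda>s. D1 s * h s) has_real_derivative D2 s * h s + D1 s * h s * D1 s) (at s)"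
        by (rule derivative_eq_intros refl deriv_h[OF s] deriv_D1[OF s])+
      then show "((\<lambda>s. D1 s * h s) has_real_derivative (D2 s + (D1 s)\<^sup>2) * h s) (at s)"
        by (simp add: algebra_simps power2_eq_square)
    qed
    have "(h \<longlongrightarrow> C * exp (\<alpha> * (?E 1 \<theta> - 1))) (at_left 1)"
      unfolding h_def using reg
      by (intro tendsto_intros degenerate_exp_tendsto_at_left_1[OF lam]) auto
    then have h_lim: "(h \<longlongrightarrow> 1) (at_left 1)"
      by (simp add: C_def flip: exp_add)
    have D1_lim: "(D1 \<longlongrightarrow> L1) (at_left 1)"
      unfolding D1_def L1_def using reg Nats \<open>lam \<le> 1\<close>
      \<comment> \<open>For \<open>lam = 1\<close> the exponent is the natural number 0; otherwise
        \<open>1 - lam\<close> is positive, which admits the endpoint.\<close>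
      by (intro tendsto_intros degenerate_exp_tendsto_at_left_1[OF lam]) (cases "lam = 1"; auto)
    have mean: "(\<lambda>k. real k * p k) sums L1"
    proof -
      have "diffs p sums L1"
      proof (rule sums_if_tendsto_at_left_1[OF _ h1_sums])
        show "((\<lambda>s. D1 s * h s) \<longlongrightarrow> L1) (at_left 1)"
          using tendsto_mult[OF D1_lim h_lim] by simp
      qed (auto simp: diffs_def p_nonneg)
      then show ?thesis by (simp add: diffs_sums_iff)
    qed
    moreover have "(\<lambda>k. real k * (real k - 1) * p k) sums (V + L1\<^sup>2)"
    \<comment> \<open>At this endpoint the exponent \<open>1 / lam - 2\<close> of \<open>D2\<close>
      may be negative, so the limit argument is avoided: the mean is 0, and a nonnegative variable
      with mean 0 has no mass off 0.\<close>
    proof (cases "1 + lam * \<theta> = 0 \<and> lam < 1")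
      case True
      then have "?E (1 - lam) \<theta> = 0"
        using lam by (intro degenerate_exp_eq_0) auto
      then have "L1 = 0" "V = 0" by (simp_all add: L1_def V_def)
      with mean have zero: "real k * p k = 0" for k
        using p_nonneg suminf_eq_zero_iff[of "\<lambda>k. real k * p k"] unfolding sums_iff by simp
      have zero2: "real k * (real k - 1) * p k = 0" for k using zero[of k] by auto
      show ?thesis unfolding zero2 by (simp add: \<open>L1 = 0\<close> \<open>V = 0\<close>)
    next
      case False
      have "(D2 \<longlongrightarrow> V) (at_left 1)"
      proof (cases "lam = 1")
        case True
        \<comment> \<open>The factor \<open>1 - lam\<close> makes both \<open>D2\<close> and
          \<open>V\<close> zero.\<close>
        then show ?thesis by (simp add: D2_def[abs_def] V_def)
      next
        case lam': False
        have reg': "1 + lam * \<theta> > 0 \<or> 1 + lam * \<theta> \<noteq> 0 \<and> 1 / lam \<in> \<int>"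
          using reg False lam' \<open>lam \<le> 1\<close> Nats_subset_Ints by fastforce
        have Ints: "- lam / lam \<in> \<int>" "(1 - lam) / lam \<in> \<int>" "(1 - 2 * lam) / lam \<in> \<int>" if "1 / lam \<in> \<int>"
          using that lam by (auto simp: diff_divide_distrib)
        \<comment> \<open>Merges the product in \<open>V\<close> into the single power that occurs
          in \<open>D2\<close>; the base is nonzero by \<open>reg'\<close>.\<close>
        have "?E (- lam) \<theta> * ?E (1 - lam) \<theta> = ?E (1 - 2 * lam) \<theta>"
          using degenerate_exp_add[OF lam, of \<theta> "- lam" "1 - lam"] reg' Ints by (auto simp: algebra_simps)
        moreover have "isCont (?E (1 - 2 * lam)) \<theta>"
          using isCont_degenerate_exp[OF lam] reg' Ints by blast
        then have "((\<lambda>s. ?E (1 - 2 * lam) (\<theta> * s)) \<longlongrightarrow> ?E (1 - 2 * lam) \<theta>) (at_left 1)"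
          by (rule isCont_tendsto_compose) (auto intro!: tendsto_eq_intros)
        then have "(D2 \<longlongrightarrow> \<alpha> * \<theta>\<^sup>2 * ((1 - lam) * ?E (1 - 2 * lam) \<theta>)) (at_left 1)"
          unfolding D2_def by (intro tendsto_intros)
        ultimately show ?thesis by (simp add: V_def mult.assoc)
      qed
      then have "((\<lambda>s. (D2 s + (D1 s)\<^sup>2) * h s) \<longlongrightarrow> (V + L1\<^sup>2) * 1) (at_left 1)"
        using D1_lim h_lim by (intro tendsto_intros)
      then have "diffs (diffs p) sums (V + L1\<^sup>2)"
        by (intro sums_if_tendsto_at_left_1[OF _ h2_sums]) (auto simp: diffs_def p_nonneg)
      then show ?thesis by (simp add: diffs_diffs_sums_iff)
    qed
    ultimately show ?thesis ..
  qed
  then have moments: "(\<lambda>k. real k * p k) sums L1" "(\<lambda>k. real k * (real k - 1) * p k) sums (V + L1\<^sup>2)"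
    by auto
  show ?thesis
    using nat_variable_moments[OF X moments[unfolded p_def]]
    by (simp add: L1_def V_def algebra_simps power2_eq_square)
qed

end
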